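(* Let $G$ be the simple undirected graph with vertex set $\{1,2,\dots,9\}$ and the following $22$ edges: $$\{1,3\},\{1,7\},\{1,9\},\{3,7\},\{3,9\},\{7,9\},$$ $$\{2,1\},\{2,3\},\{4,1\},\{4,7\},\{6,3\},\{6,9\},\{8,7\},\{8,9\},$$ $$\{2,4\},\{2,6\},\{4,8\},\{6,8\},$$ $$\{5,2\},\{5,4\},\{5,6\},\{5,8\}.$$ Then $\chi(G)=5$, and the coloring complex $\mathrm{Hom}(G,K_5)$ is $0$-connected; equivalently, the graph $G'$ whose vertices are the proper $5$-colorings $V(G)\to\{1,2,3,4,5\}$ of $G$, two of them being adjacent exactly when they differ on exactly one vertex of $G$, is connected. Consequently, the following assertion (the conjecture of Björner and Lovász) is false: for all graphs $G,H$ and every integer $k$, if $\mathrm{Hom}(G,H)$ is $k$-connected then $\chi(H)\ge \chi(G)+k+1$. Indeed it fails for this $G$ with $H=K_5$ and $k=0$.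
   Context: $\chi(G)$ denotes the chromatic number of $G$, and $K_5$ is the complete graph on the vertex set $\{1,2,3,4,5\}$. For graphs $G,H$, an $H$-coloring of $G$ is a graph homomorphism from $G$ to $H$, i.e. a map $\phi:V(G)\to V(H)$ such that $(\phi(x),\phi(y))\in E(H)$ for all $(x,y)\in E(G)$; thus $K_5$-colorings are proper $5$-colorings. The coloring complex $\mathrm{Hom}(G,H)$ is the CW-complex whose cells are the maps $\eta$ from $V(G)$ to the non-empty subsets of $V(H)$ such that $\eta(x)\times\eta(y)\subseteq E(H)$ for all $(x,y)\in E(G)$ (here $E(H)$ is regarded as a symmetric relation on $V(H)$). The cell $\eta$ is the product over $v\in V(G)$ of the simplices with vertex sets $\eta(v)$, and its closure consists of all cells $\tilde\eta$ with $\tilde\eta(v)\subseteq\eta(v)$ for all $v\in V(G)$. The $0$-cells are the $H$-colorings of $G$. A complex $C$ is $k$-connected if every continuous map $S^k\to C$ extends to a continuous map $B^{k+1}\to C$, equivalently (in the paper's convention) if all homotopy groups up to dimension $k$ are trivial. In particular, $(-1)$-connected means non-empty, and $0$-connected means (non-empty and) connected. If the vertices of $G$ are arranged as a $3\times 3$ grid with rows $(1,2,3)$, $(4,5,6)$, $(7,8,9)$, then the edges are as follows: the four corners form a clique, each mid-side vertex is joined to the two corners on its side, the four mid-side vertices form the $4$-cycle $2,4,8,6$, and the center $5$ is joined to the four mid-side vertices. *)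

theory Defs
  imports "HOL-Analysis.Analysis" "Graph_Theory.Graph_Theory"
begin

text \<open>Finite simple undirected graphs are the instances of the locale \<^locale>\<open>pair_graph\<close>:
  the set of arcs is the (symmetric, irreflexive) adjacency relation.\<close>

definition complete_graph :: "'a set \<Rightarrow> 'a pair_pre_digraph" where
  "complete_graph V = \<lparr>pverts = V, parcs = {(x, y). x \<in> V \<and> y \<in> V \<and> x \<noteq> y}\<rparr>"

definition H_colorings :: "'a pair_pre_digraph \<Rightarrow> 'b pair_pre_digraph \<Rightarrow> ('a \<Rightarrow> 'b) set" where
  "H_colorings G H =
     {\<phi> \<in> pverts G \<rightarrow>\<^sub>E pverts H. \<forall>(x, y) \<in> parcs G. (\<phi> x, \<phi> y) \<in> parcs H}"

definition chromatic_number :: "'a pair_pre_digraph \<Rightarrow> nat" where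
  "chromatic_number G = (LEAST n. H_colorings G (complete_graph {..<n}) \<noteq> {})"

definition hom_cells :: "'a pair_pre_digraph \<Rightarrow> 'b pair_pre_digraph \<Rightarrow> ('a \<Rightarrow> 'b set) set" where
  "hom_cells G H =
     {\<eta> \<in> pverts G \<rightarrow>\<^sub>E {A. A \<subseteq> pverts H \<and> A \<noteq> {}}. \<forall>(x, y) \<in> parcs G. \<eta> x \<times> \<eta> y \<subseteq> parcs H}"

text \<open>The closed simplex with vertex set \<open>A\<close> in barycentric coordinates.\<close>

definition simplex_on :: "'b set \<Rightarrow> ('b \<Rightarrow> real) set" where
  "simplex_on A = {t. (\<forall>w. 0 \<le> t w) \<and> (\<forall>w. w \<notin> A \<longrightarrow> t w = 0) \<and> (\<Sum>w\<in>A. t w) = 1}"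

text \<open>The closure of the cell \<open>\<eta>\<close> is the product of the simplices on the sets \<open>\<eta> v\<close>.
  Two closed cells \<open>\<eta>\<close>, \<open>\<eta>'\<close> meet in the product of the simplices on \<open>\<eta> v \<inter> \<eta>' v\<close>,
  which is a common face or empty, so the
  union of the closed cells is glued as prescribed. For finite graphs there are finitely many
  cells, and the subspace topology is the CW topology.\<close>

definition Hom_complex ::
    "'a pair_pre_digraph \<Rightarrow> 'b pair_pre_digraph \<Rightarrow> ('a \<Rightarrow> 'b \<Rightarrow> real) topology" where
  "Hom_complex G H =
     subtopology (product_topology (\<lambda>_. powertop_real UNIV) (pverts G))
       (\<Union>\<eta> \<in> hom_cells G H. \<Pi>\<^sub>E v \<in> pverts G. simplex_on (\<eta> v))"

text \<open>The closed unit ball of dimension \<open>n\<close>; the boundary of \<open>nball (Suc n)\<close> is \<open>nsphere n\<close>.\<close>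

definition nball :: "nat \<Rightarrow> (nat \<Rightarrow> real) topology" where
  "nball n = subtopology (Euclidean_space n) {x. (\<Sum>i<n. x i ^ 2) \<le> 1}"

text \<open>Connectivity is required in all dimensions up to \<open>k\<close>. Dimension \<open>-1\<close>
  (empty sphere, one-point ball) contributes non-emptiness.\<close>

definition k_connected :: "int \<Rightarrow> 'a topology \<Rightarrow> bool" where
  "k_connected k X \<longleftrightarrow>
     (-1 \<le> k \<longrightarrow> topspace X \<noteq> {}) \<and>
     (\<forall>i::nat. int i \<le> k \<longrightarrow>
        (\<forall>f. continuous_map (nsphere i) X f \<longrightarrow>
           (\<exists>g. continuous_map (nball (Suc i)) X g \<and> (\<forall>x \<in> topspace (nsphere i). g x = f x))))"

definition coloring_graph ::
    "'a pair_pre_digraph \<Rightarrow> 'b pair_pre_digraph \<Rightarrow> ('a \<Rightarrow> 'b) pair_pre_digraph" where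
  "coloring_graph G H =
     \<lparr>pverts = H_colorings G H,
      parcs = {(\<phi>, \<psi>). \<phi> \<in> H_colorings G H \<and> \<psi> \<in> H_colorings G H \<and>
                      (\<exists>!v. v \<in> pverts G \<and> \<phi> v \<noteq> \<psi> v)}\<rparr>"

definition grid_edges :: "(nat \<times> nat) set" where
  "grid_edges =
     {(1,3), (1,7), (1,9), (3,7), (3,9), (7,9),
      (2,1), (2,3), (4,1), (4,7), (6,3), (6,9), (8,7), (8,9),
      (2,4), (2,6), (4,8), (6,8),
      (5,2), (5,4), (5,6), (5,8)}"

definition grid_graph :: "nat pair_pre_digraph" where
  "grid_graph = \<lparr>pverts = {1..9}, parcs = grid_edges \<union> grid_edges\<inverse>\<rparr>"

definition K5 :: "nat pair_pre_digraph" where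
  "K5 = complete_graph {1..5}"

lemma pair_graph_complete_graph: "finite V \<Longrightarrow> pair_graph (complete_graph V)"
  by unfold_locales
    (auto simp: complete_graph_def symmetric_def sym_def
      intro: finite_subset [of _ "V \<times> V"])

lemma pair_graph_grid_graph: "pair_graph grid_graph"
proof -
  have "symmetric (with_proj grid_graph)"
    by (simp add: symmetric_def grid_graph_def sym_Un_converse)
  then show ?thesis
    by unfold_locales (auto simp: grid_graph_def grid_edges_def)
qed

end

theory Submission
  imports Defs
begin

text \<open>Fix the corner colours \<open>a, b, c, d\<close> (vertices 1, 3, 7, 9) and the spare colour \<open>e\<close>.
  Colorings in which vertex 2 or 8 has colour \<open>e\<close> can all be recoloured into one another, and
  likewise those in which vertex 4 or 6 has colour \<open>e\<close>; apart from these there are only two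
  colorings, in which the centre has colour \<open>e\<close> and nothing but a corner can move. Recolouring a
  corner with \<open>e\<close> exchanges \<open>e\<close> with that corner's colour, and combining such moves yields every
  transposition of \<open>e\<close> with a corner colour within the first class, hence every permutation of the
  colours.

  Every point of the complex is joined inside a closed cell to a vertex, and adjacent colorings span
  an edge, so connectedness of the graph of colorings gives path-connectedness of the complex.\<close>

subsection \<open>Path-connectedness of coloring complexes\<close>

text \<open>The 0-sphere is the pair of points +1 and -1 on a line and the 1-ball is the segment
  between them. A path joining the two images, reparametrised from [0,1] to [-1,1], is the required
  extension.\<close>

lemma k_connected_0_if_path_connected:
  assumes "topspace X \<noteq> {}" "path_connected_space X"
  shows "k_connected 0 X"
proof -
  have "\<exists>g. continuous_map (nball (Suc 0)) X g \<and> (\<forall>x \<in> topspace (nsphere 0). g x = f x)"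
    if f: "continuous_map (nsphere 0) X f" for f
  proof -
    define pt where "pt r = (\<lambda>i::nat. if i = 0 then r else 0::real)" for r
    have sphere: "topspace (nsphere 0) = {pt 1, pt (-1)}"
    proof -
      have "x = pt (x 0)" if "\<forall>i\<ge>Suc 0. x i = 0" for x
        using that by (auto simp: pt_def fun_eq_iff)
      then show ?thesis
        by (auto simp: nsphere topspace_Euclidean_space power2_eq_1_iff) (auto simp: pt_def power2_eq_1_iff)
    qed
    then have "f (pt (-1)) \<in> topspace X" "f (pt 1) \<in> topspace X"
      using continuous_map_image_subset_topspace[OF f] by auto
    with assms(2) obtain p where p: "pathin X p" "p 0 = f (pt (-1))" "p 1 = f (pt 1)"
      unfolding path_connected_space_def by metis
    have "continuous_map (nball (Suc 0)) euclideanreal (\<lambda>x. (1 + x 0) / 2)"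
      unfolding nball_def Euclidean_space_def
      by (intro continuous_intros continuous_map_from_subtopology) auto
    moreover have "(1 + x 0) / 2 \<in> {0..1}" if "x \<in> topspace (nball (Suc 0))" for x
      using that by (simp add: nball_def abs_square_le_1 abs_le_iff)
    ultimately have "continuous_map (nball (Suc 0)) (top_of_set {0..1}) (\<lambda>x. (1 + x 0) / 2)"
      by (auto simp: continuous_map_in_subtopology)
    then have "continuous_map (nball (Suc 0)) X (p \<circ> (\<lambda>x. (1 + x 0) / 2))"
      by (rule continuous_map_compose) (use p(1) in \<open>simp add: pathin_def\<close>)
    then show ?thesis
      by (intro exI[of _ "p \<circ> (\<lambda>x. (1 + x 0) / 2)"] conjI) (use p in \<open>auto simp: sphere pt_def\<close>)
  qed
  then show ?thesis
    using assms(1) by (auto simp: k_connected_def)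
qed

section \<open>Closed cells and paths inside them\<close>

definition closed_cell :: "'a set \<Rightarrow> ('a \<Rightarrow> 'b set) \<Rightarrow> ('a \<Rightarrow> 'b \<Rightarrow> real) set" where
  "closed_cell V \<eta> = (\<Pi>\<^sub>E v \<in> V. simplex_on (\<eta> v))"

lemma topspace_Hom_complex:
  "topspace (Hom_complex G H) = (\<Union>\<eta> \<in> hom_cells G H. closed_cell (pverts G) \<eta>)"
  by (auto simp: Hom_complex_def closed_cell_def PiE_def)

lemma simplex_on_convex:
  assumes "s \<in> simplex_on A" "t \<in> simplex_on A" "0 \<le> r" "r \<le> 1"
  shows "(\<lambda>w. (1 - r) * s w + r * t w) \<in> simplex_on A"
  using assms by (auto simp: simplex_on_def sum.distrib simp flip: sum_distrib_left)

lemma path_component_of_closed_cell: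
  assumes \<eta>: "\<eta> \<in> hom_cells G H"
    and x: "x \<in> closed_cell (pverts G) \<eta>" and y: "y \<in> closed_cell (pverts G) \<eta>"
  shows "path_component_of (Hom_complex G H) x y"
proof -
  \<comment> \<open>The straight segment; products of simplices are convex. Restricting to
    \<open>pverts G\<close> keeps its points extensional, as the product topology demands.\<close>
  define p where "p r = (\<lambda>v \<in> pverts G. \<lambda>w. (1 - r) * x v w + r * y v w)" for r
  have "p r \<in> closed_cell (pverts G) \<eta>" if "r \<in> {0..1}" for r
    using that x y by (auto simp: p_def closed_cell_def intro!: simplex_on_convex)
  moreover have "pathin (product_topology (\<lambda>_. powertop_real UNIV) (pverts G)) p"
    unfolding pathin_def continuous_map_componentwise continuous_map_componentwise_UNIV
    by (auto simp: p_def intro!: continuous_intros)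
  ultimately have "pathin (Hom_complex G H) p"
    using \<eta> unfolding Hom_complex_def pathin_subtopology closed_cell_def[symmetric] by blast
  moreover have "p 0 = x" "p 1 = y"
    using x y by (auto simp: p_def closed_cell_def fun_eq_iff PiE_def extensional_def)
  ultimately show ?thesis
    unfolding path_component_of_def by blast
qed

text \<open>The 0-cell of a coloring in barycentric coordinates.\<close>

definition coloring_point :: "'a set \<Rightarrow> ('a \<Rightarrow> 'b) \<Rightarrow> 'a \<Rightarrow> 'b \<Rightarrow> real" where
  "coloring_point V \<phi> = (\<lambda>v \<in> V. \<lambda>w. if w = \<phi> v then 1 else 0)"

lemma coloring_point_in_closed_cell:
  assumes "\<And>v. v \<in> V \<Longrightarrow> finite (\<eta> v)" "\<And>v. v \<in> V \<Longrightarrow> \<phi> v \<in> \<eta> v"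
  shows "coloring_point V \<phi> \<in> closed_cell V \<eta>"
  using assms by (auto simp: coloring_point_def closed_cell_def simplex_on_def)

lemma wf_coloring_graph: "pair_wf_digraph (coloring_graph G H)"
  by unfold_locales (simp_all add: coloring_graph_def split_beta)

context
  fixes G :: "'a pair_pre_digraph" and H :: "'b pair_pre_digraph"
  assumes G: "pair_graph G"
begin

interpretation pair_graph G by (rule G)

lemma Hom_complex_edge:
  assumes "(\<phi>, \<psi>) \<in> parcs (coloring_graph G H)"
  shows "path_component_of (Hom_complex G H)
    (coloring_point (pverts G) \<phi>) (coloring_point (pverts G) \<psi>)"
proof -
  from assms obtain u where col: "\<phi> \<in> H_colorings G H" "\<psi> \<in> H_colorings G H"
    and u: "u \<in> pverts G" "\<phi> u \<noteq> \<psi> u" and eq: "\<And>v. v \<in> pverts G \<Longrightarrow> v \<noteq> u \<Longrightarrow> \<phi> v = \<psi> v"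
    by (auto simp: coloring_graph_def)
  \<comment> \<open>The 1-cell spanned by the two colorings: a singleton at every vertex except
    \<open>u\<close>.\<close>
  define \<eta> where "\<eta> = (\<lambda>v \<in> pverts G. {\<phi> v, \<psi> v})"
  have "\<eta> v \<times> \<eta> w \<subseteq> parcs H" if vw: "(v, w) \<in> parcs G" for v w
  proof -
    have "v \<in> pverts G" "w \<in> pverts G" "v \<noteq> w"
      using vw wellformed' no_loops' by auto
    moreover have "(\<phi> v, \<phi> w) \<in> parcs H" "(\<psi> v, \<psi> w) \<in> parcs H"
      using vw col by (auto simp: H_colorings_def)
    \<comment> \<open>As there are no loops, at most one of \<open>v\<close>, \<open>w\<close> is
      \<open>u\<close>, so each pair in the product already occurs as the image of the arc under
      \<phi> or \<psi>.\<close>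
    ultimately show ?thesis
      using eq[of v] eq[of w] by (cases "v = u") (auto simp: \<eta>_def)
  qed
  moreover have "\<eta> \<in> pverts G \<rightarrow>\<^sub>E {A. A \<subseteq> pverts H \<and> A \<noteq> {}}"
    using col by (auto simp: H_colorings_def \<eta>_def)
  ultimately have "\<eta> \<in> hom_cells G H"
    unfolding hom_cells_def by blast
  then show ?thesis
    by (rule path_component_of_closed_cell)
      (auto intro!: coloring_point_in_closed_cell simp: \<eta>_def)
qed

lemma coloring_point_in_topspace:
  assumes "\<phi> \<in> H_colorings G H"
  shows "coloring_point (pverts G) \<phi> \<in> topspace (Hom_complex G H)"
proof -
  have "(\<lambda>v \<in> pverts G. {\<phi> v}) \<in> hom_cells G H"
    using assms wellformed' by (auto simp: hom_cells_def H_colorings_def)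
  moreover have "coloring_point (pverts G) \<phi> \<in> closed_cell (pverts G) (\<lambda>v \<in> pverts G. {\<phi> v})"
    by (rule coloring_point_in_closed_cell) auto
  ultimately show ?thesis
    unfolding topspace_Hom_complex by blast
qed

text \<open>Choosing one colour from each \<eta> v gives a vertex of the same closed cell.\<close>

lemma Hom_complex_vertex:
  assumes "x \<in> topspace (Hom_complex G H)"
  obtains \<phi> where "\<phi> \<in> H_colorings G H"
    "path_component_of (Hom_complex G H) x (coloring_point (pverts G) \<phi>)"
proof -
  from assms obtain \<eta> where \<eta>: "\<eta> \<in> hom_cells G H" and x: "x \<in> closed_cell (pverts G) \<eta>"
    by (auto simp: topspace_Hom_complex)
  define \<phi> where "\<phi> = (\<lambda>v \<in> pverts G. SOME w. w \<in> \<eta> v)"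
  have \<phi>: "\<phi> v \<in> \<eta> v" if "v \<in> pverts G" for v
    using that \<eta> some_in_eq[of "\<eta> v"] by (auto simp: \<phi>_def hom_cells_def PiE_def Pi_def)
  have fin: "finite (\<eta> v)" if "v \<in> pverts G" for v
  proof (rule ccontr)
    assume "infinite (\<eta> v)"
    \<comment> \<open>A sum over an infinite set is 0 by convention, so the coordinates cannot add
      up to 1.\<close>
    then have "simplex_on (\<eta> v) = {}" by (simp add: simplex_on_def)
    with x that show False by (auto simp: closed_cell_def PiE_def Pi_def)
  qed
  have "\<phi> \<in> H_colorings G H"
    unfolding H_colorings_def
  proof (safe intro!: PiE_I)
    show "\<phi> v \<in> pverts H" if "v \<in> pverts G" for v
      using \<phi>[OF that] \<eta> that by (auto simp: hom_cells_def PiE_def Pi_def)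
    show "\<phi> v = undefined" if "v \<notin> pverts G" for v
      using that by (simp add: \<phi>_def)
    show "(\<phi> v, \<phi> w) \<in> parcs H" if "(v, w) \<in> parcs G" for v w
    proof -
      have "\<eta> v \<times> \<eta> w \<subseteq> parcs H"
        using \<eta> that by (auto simp: hom_cells_def)
      then show ?thesis
        using \<phi> wellformed'[OF that] by blast
    qed
  qed
  moreover have "path_component_of (Hom_complex G H) x (coloring_point (pverts G) \<phi>)"
    by (rule path_component_of_closed_cell[OF \<eta> x coloring_point_in_closed_cell[OF fin \<phi>]])
  ultimately show thesis by (rule that)
qed

lemma path_connected_Hom_complex:
  assumes conn: "\<And>\<phi> \<psi>. \<phi> \<in> H_colorings G H \<Longrightarrow> \<psi> \<in> H_colorings G H \<Longrightarrow>
      (\<phi>, \<psi>) \<in> (parcs (coloring_graph G H))\<^sup>*"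
  shows "path_connected_space (Hom_complex G H)"
  unfolding path_connected_space_iff_path_component
proof safe
  let ?X = "Hom_complex G H" and ?pt = "coloring_point (pverts G) :: ('a \<Rightarrow> 'b) \<Rightarrow> _"
  fix x y assume "x \<in> topspace ?X" "y \<in> topspace ?X"
  then obtain \<phi> \<psi> where col: "\<phi> \<in> H_colorings G H" "\<psi> \<in> H_colorings G H"
    and xy: "path_component_of ?X x (?pt \<phi>)" "path_component_of ?X y (?pt \<psi>)"
    by (metis Hom_complex_vertex)
  from conn[OF col] have "path_component_of ?X (?pt \<phi>) (?pt \<psi>)"
  proof (induction rule: rtrancl_induct)
    case base
    \<comment> \<open>\<open>path_component_of\<close> is reflexive only on the topspace; going to
      \<open>x\<close> and back supplies this.\<close>
    show ?case
      by (rule path_component_of_trans[OF path_component_of_sym[OF xy(1)] xy(1)])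
  next
    case (step \<psi> \<psi>')
    show ?case
      by (rule path_component_of_trans[OF step.IH Hom_complex_edge[OF step.hyps(2)]])
  qed
  with xy show "path_component_of ?X x y"
    by (metis path_component_of_sym path_component_of_trans)
qed

end

subsection \<open>Recolouring the grid\<close>

text \<open>Recursive, so that simplification decides it on explicit lists of symbolic colours.
  Equal lists are allowed, so a move may leave everything unchanged when the target colour is
  already there.\<close>

primrec at_most_one_diff :: "'a list \<Rightarrow> 'a list \<Rightarrow> bool" where
  "at_most_one_diff [] ys \<longleftrightarrow> ys = []"
| "at_most_one_diff (x # xs) ys \<longleftrightarrow> ys \<noteq> [] \<and> (xs = tl ys \<or> x = hd ys \<and> at_most_one_diff xs (tl ys))"

lemma at_most_one_diff_sym: "at_most_one_diff xs ys \<Longrightarrow> at_most_one_diff ys xs"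
proof (induction xs arbitrary: ys)
  case (Cons x xs)
  then show ?case by (cases ys) auto
qed simp

lemma at_most_one_diff_nth:
  "at_most_one_diff xs ys \<Longrightarrow> length ys = length xs \<and>
     (\<forall>i j. i < length xs \<longrightarrow> j < length xs \<longrightarrow> xs ! i \<noteq> ys ! i \<longrightarrow> xs ! j \<noteq> ys ! j \<longrightarrow> i = j)"
proof (induction xs arbitrary: ys)
  case (Cons x xs)
  then obtain y zs where ys: "ys = y # zs" by (cases ys) auto
  with Cons.prems consider "xs = zs" | "x = y" "at_most_one_diff xs zs" by auto
  then show ?case
  proof cases
    case 1
    then show ?thesis by (auto simp: ys nth_Cons split: nat.splits)
  next
    case 2
    with Cons.IH[OF this(2)] show ?thesis by (simp add: ys nth_Cons split: nat.split)
  qed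
qed simp

text \<open>Colorings of the grid are represented as lists in row order; vertex \<open>v\<close> is position \<open>v - 1\<close>.\<close>

definition proper :: "nat list \<Rightarrow> bool" where
  "proper xs \<longleftrightarrow>
     length xs = 9 \<and> set xs \<subseteq> {1..5} \<and> (\<forall>(u, v) \<in> grid_edges. xs ! (u - 1) \<noteq> xs ! (v - 1))"

text \<open>Each of the 22 edges appears at one endpoint. In this form automation checks every
  recolouring below.\<close>

lemma proper_grid:
  "proper [x1, x2, x3, x4, x5, x6, x7, x8, x9] \<longleftrightarrow>
     {x1, x2, x3, x4, x5, x6, x7, x8, x9} \<subseteq> {1..5} \<and> distinct [x1, x3, x7, x9] \<and>
     x2 \<notin> {x1, x3, x4, x6, x5} \<and> x4 \<notin> {x1, x7, x8, x5} \<and>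
     x6 \<notin> {x3, x9, x8, x5} \<and> x8 \<notin> {x7, x9, x5}"
  unfolding proper_def grid_edges_def by auto

definition recolor :: "nat list \<Rightarrow> nat list \<Rightarrow> bool" where
  "recolor xs ys \<longleftrightarrow> proper xs \<and> proper ys \<and> at_most_one_diff xs ys"

abbreviation linked :: "nat list \<Rightarrow> nat list \<Rightarrow> bool" where
  "linked \<equiv> recolor\<^sup>*\<^sup>*"

lemma linked_sym: "linked xs ys \<Longrightarrow> linked ys xs"
  by (rule sympD[OF symp_rtranclp]) (auto simp: symp_def recolor_def intro: at_most_one_diff_sym)

lemma linked_step: "proper xs \<Longrightarrow> proper ys \<Longrightarrow> at_most_one_diff xs ys \<Longrightarrow> linked xs ys"
  by (auto simp: recolor_def)

section \<open>Corner colours, the spare colour and the diagonal reflection\<close>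

definition palette :: "nat \<Rightarrow> nat \<Rightarrow> nat \<Rightarrow> nat \<Rightarrow> nat \<Rightarrow> bool" where
  "palette a b c d e \<longleftrightarrow> distinct [a, b, c, d, e] \<and> {a, b, c, d, e} = {1..5}"

lemma palette_in:
  assumes "palette a b c d e"
  shows "a \<noteq> b" "a \<noteq> c" "a \<noteq> d" "a \<noteq> e" "b \<noteq> c" "b \<noteq> d" "b \<noteq> e" "c \<noteq> d" "c \<noteq> e" "d \<noteq> e"
    "{a, b, c, d, e} \<subseteq> {1..5}"
  using assms by (auto simp: palette_def)

lemma proper_corners:
  assumes "proper [a, x2, b, x4, x5, x6, c, x8, d]"
  obtains e where "palette a b c d e"
proof -
  have *: "card {a, b, c, d} = 4" "{a, b, c, d} \<subseteq> {1..5}"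
    using assms by (auto simp: proper_grid)
  then have "card ({1..5} - {a, b, c, d}) = 1"
    by (simp add: card_Diff_subset)
  then obtain e where e: "{1..5} - {a, b, c, d} = {e}"
    by (auto simp: card_1_singleton_iff)
  then have "{a, b, c, d, e} = {1..5}" "e \<notin> {a, b, c, d}"
    using *(2) by blast+
  moreover have "distinct [a, b, c, d]"
    using assms by (simp add: proper_grid)
  ultimately have "palette a b c d e"
    unfolding palette_def by auto
  then show thesis by (rule that)
qed

text \<open>Reflection in the main diagonal, an automorphism of the grid graph exchanging the
  corners 3 and 7 and the two middle lines.\<close>

definition transpose_grid :: "'a list \<Rightarrow> 'a list" where
  "transpose_grid xs = map (\<lambda>i. xs ! i) [0, 3, 6, 1, 4, 7, 2, 5, 8]"

lemma transpose_grid_simp [simp]: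
  "transpose_grid [x1, x2, x3, x4, x5, x6, x7, x8, x9] = [x1, x4, x7, x2, x5, x8, x3, x6, x9]"
  by (simp add: transpose_grid_def)

lemma proper_exhaust:
  assumes "proper xs"
  obtains x1 x2 x3 x4 x5 x6 x7 x8 x9 where "xs = [x1, x2, x3, x4, x5, x6, x7, x8, x9]"
  using assms unfolding proper_def
  by (auto simp: numeral_eq_Suc length_Suc_conv)

lemma proper_transpose_grid: "proper xs \<Longrightarrow> proper (transpose_grid xs)"
  by (rule proper_exhaust, assumption) (auto simp: proper_grid)

lemma at_most_one_diff_transpose_grid:
  assumes "proper xs" "proper ys" "at_most_one_diff xs ys"
  shows "at_most_one_diff (transpose_grid xs) (transpose_grid ys)"
proof -
  obtain x1 x2 x3 x4 x5 x6 x7 x8 x9 where "xs = [x1, x2, x3, x4, x5, x6, x7, x8, x9]"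
    by (rule proper_exhaust[OF assms(1)])
  moreover obtain y1 y2 y3 y4 y5 y6 y7 y8 y9 where "ys = [y1, y2, y3, y4, y5, y6, y7, y8, y9]"
    by (rule proper_exhaust[OF assms(2)])
  ultimately show ?thesis
    using assms(3) by auto
qed

lemma linked_transpose_grid:
  "linked xs ys \<Longrightarrow> linked (transpose_grid xs) (transpose_grid ys)"
proof (induction rule: rtranclp_induct)
  case (step ys zs)
  from step.hyps(2) have "recolor (transpose_grid ys) (transpose_grid zs)"
    by (auto simp: recolor_def intro: proper_transpose_grid at_most_one_diff_transpose_grid)
  with step.IH show ?case by simp
qed simp

text \<open>Representatives of the colorings with the spare colour \<open>e\<close> on the vertical middle line
  (vertices 2, 8) and on the horizontal one (vertices 4, 6); the corners 1, 3, 7, 9 are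
  coloured \<open>a, b, c, d\<close>.\<close>

definition vcol :: "nat \<Rightarrow> nat \<Rightarrow> nat \<Rightarrow> nat \<Rightarrow> nat \<Rightarrow> nat list" where
  "vcol a b c d e = [a, e, b, d, b, a, c, e, d]"

definition hcol :: "nat \<Rightarrow> nat \<Rightarrow> nat \<Rightarrow> nat \<Rightarrow> nat \<Rightarrow> nat list" where
  "hcol a b c d e = transpose_grid (vcol a c b d e)"

text \<open>With \<open>e\<close> on vertices 2 and 8, vertex 4 can only have \<open>b\<close> or
  \<open>d\<close> and vertex 6 only \<open>a\<close> or \<open>c\<close>; these two are not
  adjacent, so they can be adjusted one after the other.\<close>

lemma linked_vcol_aux:
  assumes pal: "palette a b c d e" and pr: "proper [a, e, b, p, y, q, c, e, d]"
  shows "linked [a, e, b, p, y, q, c, e, d] (vcol a b c d e)"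
proof -
  note P = palette_in[OF pal]
  have "{p, q} \<subseteq> {a, b, c, d, e}"
    using pr pal by (simp add: proper_grid palette_def)
  then have "p = b \<or> p = d" "q = a \<or> q = c"
    using pr P by (auto simp: proper_grid)
  \<comment> \<open>Once vertex 4 has colour \<open>d\<close>, the centre can take \<open>b\<close>
    for either \<open>q\<close>, and vertex 6 is then free to become \<open>a\<close>.\<close>
  have d: "linked [a, e, b, d, y', q, c, e, d] (vcol a b c d e)"
    if "proper [a, e, b, d, y', q, c, e, d]" for y'
  proof -
    have "linked [a, e, b, d, y', q, c, e, d] [a, e, b, d, b, q, c, e, d]"
      by (rule linked_step[OF that]) (use that P in \<open>auto simp: proper_grid\<close>)
    also have "linked \<dots> (vcol a b c d e)"
      by (rule linked_step) (use that P in \<open>auto simp: vcol_def proper_grid\<close>)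
    finally show ?thesis .
  qed
  show ?thesis
  proof (cases "p = d")
    case True
    with d pr show ?thesis by blast
  next
    case False
    then have pb: "p = b" using \<open>p = b \<or> p = d\<close> by simp
    \<comment> \<open>the centre may have colour \<open>d\<close>, so it has to move away before vertex 4 does\<close>
    define z where "z = (if q = a then c else a)"
    have "linked [a, e, b, p, y, q, c, e, d] [a, e, b, b, z, q, c, e, d]"
      by (rule linked_step[OF pr])
        (use pr P \<open>q = a \<or> q = c\<close> in \<open>auto simp: pb z_def proper_grid\<close>)
    also have "linked \<dots> [a, e, b, d, z, q, c, e, d]"
      by (rule linked_step)
        (use pr P \<open>q = a \<or> q = c\<close> in \<open>auto simp: pb z_def proper_grid\<close>)
    also have "linked \<dots> (vcol a b c d e)"
      by (rule d) (use pr P \<open>q = a \<or> q = c\<close> in \<open>auto simp: pb z_def proper_grid\<close>)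
    finally show ?thesis .
  qed
qed

text \<open>If one of 2 and 8 has colour \<open>e\<close>, so can the other: their common neighbours
  4, 5, 6 already avoid \<open>e\<close>, and the corners never have it.\<close>

lemma linked_vcol:
  assumes pal: "palette a b c d e" and pr: "proper [a, x2, b, x4, x5, x6, c, x8, d]"
    and e: "x2 = e \<or> x8 = e"
  shows "linked [a, x2, b, x4, x5, x6, c, x8, d] (vcol a b c d e)"
proof -
  have pr': "proper [a, e, b, x4, x5, x6, c, e, d]"
    using e pr palette_in[OF pal] by (auto simp: proper_grid)
  have "linked [a, x2, b, x4, x5, x6, c, x8, d] [a, e, b, x4, x5, x6, c, e, d]"
    by (rule linked_step[OF pr pr']) (use e in auto)
  also have "linked \<dots> (vcol a b c d e)"
    by (rule linked_vcol_aux[OF pal pr'])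
  finally show ?thesis .
qed

lemma linked_hcol:
  assumes pal: "palette a b c d e" and pr: "proper [a, x2, b, x4, x5, x6, c, x8, d]"
    and e: "x4 = e \<or> x6 = e"
  shows "linked [a, x2, b, x4, x5, x6, c, x8, d] (hcol a b c d e)"
proof -
  have "palette a c b d e" "proper [a, x4, c, x2, x5, x8, b, x6, d]"
    using pal pr by (auto simp: palette_def proper_grid)
  from linked_transpose_grid[OF linked_vcol[OF this e]] show ?thesis
    by (simp add: hcol_def)
qed

text \<open>Moving \<open>e\<close> off vertex 2 frees corner 1 to take it. The spare colour is then
  \<open>a\<close>, which sits on vertex 6, so the line switches from vertical to
  horizontal.\<close>

lemma linked_vcol_hcol1:
  assumes pal: "palette a b c d e"
  shows "linked (vcol a b c d e) (hcol e b c d a)"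
proof -
  note P = palette_in[OF pal]
  have "linked (vcol a b c d e) [a, c, b, d, b, a, c, e, d]"
    by (rule linked_step) (use P in \<open>auto simp: vcol_def proper_grid\<close>)
  also have "linked \<dots> [e, c, b, d, b, a, c, e, d]"
    by (rule linked_step) (use P in \<open>auto simp: proper_grid\<close>)
  also have "linked \<dots> (hcol e b c d a)"
    by (rule linked_hcol) (use pal P in \<open>auto simp: proper_grid palette_def\<close>)
  finally show ?thesis .
qed

lemma linked_vcol_hcol3:
  assumes pal: "palette a b c d e"
  shows "linked (vcol a b c d e) (hcol a e c d b)"
proof -
  note P = palette_in[OF pal]
  \<comment> \<open>Another member of the vertical class, chosen with \<open>b\<close> on vertex 4:
    when corner 3 later takes \<open>e\<close>, the new spare colour \<open>b\<close> lies on the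
    horizontal line.\<close>
  have "linked (vcol a b c d e) [a, e, b, b, a, c, c, e, d]"
    by (rule linked_sym[OF linked_vcol])
      (use pal P in \<open>auto simp: proper_grid\<close>)
  also have "linked \<dots> [a, d, b, b, a, c, c, e, d]"
    by (rule linked_step) (use P in \<open>auto simp: proper_grid\<close>)
  also have "linked \<dots> [a, d, e, b, a, c, c, e, d]"
    by (rule linked_step) (use P in \<open>auto simp: proper_grid\<close>)
  also have "linked \<dots> (hcol a e c d b)"
    by (rule linked_hcol) (use pal P in \<open>auto simp: proper_grid palette_def\<close>)
  finally show ?thesis .
qed

text \<open>In \<open>F\<close> and \<open>F'\<close> every edge vertex and the centre see all four other colours.\<close>

lemma linked_frozen:
  assumes pal: "palette a b c d e"
  defines "F \<equiv> [a, c, b, d, e, a, c, b, d]" and "F' \<equiv> [a, d, b, b, e, c, c, a, d]"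
  shows "linked F (hcol e b c d a)" "linked F (vcol a e c d b)" "linked F (vcol a b e d c)"
    and "linked F' (vcol e b c d a)" "linked F' (vcol a b c e d)" "linked F' (hcol a e c d b)"
proof -
  note P = palette_in[OF pal]
  have pF: "proper F" "proper F'"
    using P by (auto simp: F_def F'_def proper_grid)
  \<comment> \<open>Only the centre has colour \<open>e\<close>, so any corner may take it. The
    corner's old colour becomes spare, and the mid-side vertex carrying it decides the
    class.\<close>
  have "linked F [e, c, b, d, e, a, c, b, d]"
    by (rule linked_step[OF pF(1)]) (use P in \<open>auto simp: F_def proper_grid\<close>)
  also have "linked \<dots> (hcol e b c d a)"
    by (rule linked_hcol) (use pal P in \<open>auto simp: proper_grid palette_def\<close>)
  finally show "linked F (hcol e b c d a)" .
  have "linked F [a, c, e, d, e, a, c, b, d]"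
    by (rule linked_step[OF pF(1)]) (use P in \<open>auto simp: F_def proper_grid\<close>)
  also have "linked \<dots> (vcol a e c d b)"
    by (rule linked_vcol) (use pal P in \<open>auto simp: proper_grid palette_def\<close>)
  finally show "linked F (vcol a e c d b)" .
  have "linked F [a, c, b, d, e, a, e, b, d]"
    by (rule linked_step[OF pF(1)]) (use P in \<open>auto simp: F_def proper_grid\<close>)
  also have "linked \<dots> (vcol a b e d c)"
    by (rule linked_vcol) (use pal P in \<open>auto simp: proper_grid palette_def\<close>)
  finally show "linked F (vcol a b e d c)" .
  have "linked F' [e, d, b, b, e, c, c, a, d]"
    by (rule linked_step[OF pF(2)]) (use P in \<open>auto simp: F'_def proper_grid\<close>)
  also have "linked \<dots> (vcol e b c d a)"
    by (rule linked_vcol) (use pal P in \<open>auto simp: proper_grid palette_def\<close>)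
  finally show "linked F' (vcol e b c d a)" .
  have "linked F' [a, d, b, b, e, c, c, a, e]"
    by (rule linked_step[OF pF(2)]) (use P in \<open>auto simp: F'_def proper_grid\<close>)
  also have "linked \<dots> (vcol a b c e d)"
    by (rule linked_vcol) (use pal P in \<open>auto simp: proper_grid palette_def\<close>)
  finally show "linked F' (vcol a b c e d)" .
  have "linked F' [a, d, e, b, e, c, c, a, d]"
    by (rule linked_step[OF pF(2)]) (use P in \<open>auto simp: F'_def proper_grid\<close>)
  also have "linked \<dots> (hcol a e c d b)"
    by (rule linked_hcol) (use pal P in \<open>auto simp: proper_grid palette_def\<close>)
  finally show "linked F' (hcol a e c d b)" .
qed

lemma linked_vcol_swap:
  assumes pal: "palette a b c d e"
  shows "linked (vcol a b c d e) (vcol e b c d a)" "linked (vcol a b c d e) (vcol a e c d b)"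
    "linked (vcol a b c d e) (vcol a b e d c)" "linked (vcol a b c d e) (vcol a b c e d)"
  using linked_vcol_hcol1[OF pal] linked_vcol_hcol3[OF pal] linked_frozen[OF pal]
  by (meson linked_sym rtranclp_trans)+

text \<open>The transpositions of the spare colour with a corner colour generate all permutations.\<close>

lemma linked_vcol_12345:
  assumes pal: "palette a b c d e"
  shows "linked (vcol a b c d e) (vcol 1 2 3 4 5)"
proof -
  let ?R = "\<lambda>a b c d e. linked (vcol a b c d e) (vcol 1 2 3 4 5)"
  have s: "?R e b c d a \<Longrightarrow> ?R a b c d e" "?R a e c d b \<Longrightarrow> ?R a b c d e"
    "?R a b e d c \<Longrightarrow> ?R a b c d e" "?R a b c e d \<Longrightarrow> ?R a b c d e"
    if "palette a b c d e" for a b c d e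
    using linked_vcol_swap[OF that] by (blast intro: rtranclp_trans)+
  have sw: "palette e b c d a" "palette a e c d b" "palette a b e d c" "palette a b c e d"
    if "palette a b c d e" for a b c d e
    using that by (auto simp: palette_def)
  \<comment> \<open>The facts \<open>4\<close>, \<open>3\<close>, \<open>2\<close> settle the
    corners from the last backwards, each assuming all earlier corners correct.\<close>
  have 4: "?R 1 2 3 d e" if p: "palette 1 2 3 d e" for d e
  proof -
    have "4 \<in> {1, 2, 3, d, e}" "5 \<in> {1, 2, 3, d, e}"
      using p by (auto simp: palette_def)
    then consider "d = 4" "e = 5" | "d = 5" "e = 4" by auto
    then show ?thesis
      using s(4)[OF p] by cases auto
  qed
  have 3: "?R 1 2 c d e" if p: "palette 1 2 c d e" for c d e
  proof -
    \<comment> \<open>If the wanted colour is spare, one swap puts it in place; if it sits on a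
      later corner, a swap first makes it spare.\<close>
    have e: "?R 1 2 c d 3" if "palette 1 2 c d 3" for c d
      by (rule s(3)[OF that 4[OF sw(3)[OF that]]])
    have "3 \<in> {1, 2, c, d, e}"
      using p by (auto simp: palette_def)
    then consider "c = 3" | "d = 3" | "e = 3" by auto
    then show ?thesis
      using 4[of d e] e[of c d] e[of c e] s[OF p] sw[OF p] p by cases simp_all
  qed
  have 2: "?R 1 b c d e" if p: "palette 1 b c d e" for b c d e
  proof -
    have e: "?R 1 b c d 2" if "palette 1 b c d 2" for b c d
      by (rule s(2)[OF that 3[OF sw(2)[OF that]]])
    have "2 \<in> {1, b, c, d, e}"
      using p by (auto simp: palette_def)
    then consider "b = 2" | "c = 2" | "d = 2" | "e = 2" by auto
    then show ?thesis
      using 3[of c d e] e[of b c d] e[of b e d] e[of b c e] s[OF p] sw[OF p] p by cases simp_all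
  qed
  have e: "?R a b c d 1" if "palette a b c d 1" for a b c d
    by (rule s(1)[OF that 2[OF sw(1)[OF that]]])
  have "1 \<in> {a, b, c, d, e}"
    using pal by (auto simp: palette_def)
  then consider "a = 1" | "b = 1" | "c = 1" | "d = 1" | "e = 1" by auto
  then show ?thesis
    using 2[of b c d e] e[of a b c d] e[of a e c d] e[of a b e d] e[of a b c e]
      s[OF pal] sw[OF pal] pal by cases simp_all
qed

lemma proper_linked_12345:
  assumes "proper xs"
  shows "linked xs (vcol 1 2 3 4 5)"
proof -
  obtain a x2 b x4 x5 x6 c x8 d where xs: "xs = [a, x2, b, x4, x5, x6, c, x8, d]"
    by (rule proper_exhaust[OF assms])
  note pr = assms[unfolded xs]
  obtain e where pal: "palette a b c d e"
    by (rule proper_corners[OF pr])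
  note P = palette_in[OF pal]
  have V: "linked (vcol p q r s t) (vcol 1 2 3 4 5)" if "{p, q, r, s, t} = {a, b, c, d, e}"
    "distinct [p, q, r, s, t]" for p q r s t
    by (rule linked_vcol_12345) (use that pal in \<open>auto simp: palette_def\<close>)
  have mem: "{x2, x4, x5, x6, x8} \<subseteq> {1..5}"
    using pr by (auto simp: proper_grid)
  then have mem: "{x2, x4, x5, x6, x8} \<subseteq> {a, b, c, d, e}"
    using pal by (simp add: palette_def)
  \<comment> \<open>Without \<open>e\<close> on 2, 4, 6, 8, each of these has two options, the
    corner colours of the opposite side. Choosing \<open>c\<close> or \<open>d\<close> at vertex 2
    forces the rest around the 4-cycle, and the centre must be \<open>e\<close>.\<close>
  consider (v) "x2 = e \<or> x8 = e" | (h) "x4 = e \<or> x6 = e"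
    | (f) "xs = [a, c, b, d, e, a, c, b, d]" | (f') "xs = [a, d, b, b, e, c, c, a, d]"
    using pr mem unfolding xs by (auto simp: proper_grid)
  then show ?thesis
  proof cases
    case v
    have "linked xs (vcol a b c d e)"
      unfolding xs by (rule linked_vcol[OF pal pr v])
    also have "linked \<dots> (vcol 1 2 3 4 5)"
      by (rule V) (use P in auto)
    finally show ?thesis .
  next
    case h
    have "linked xs (hcol a b c d e)"
      unfolding xs by (rule linked_hcol[OF pal pr h])
    \<comment> \<open>The earlier link with \<open>a\<close> and \<open>e\<close> exchanged, read
      backwards.\<close>
    also have "linked \<dots> (vcol e b c d a)"
      by (rule linked_sym[OF linked_vcol_hcol1]) (use pal in \<open>auto simp: palette_def\<close>)
    also have "linked \<dots> (vcol 1 2 3 4 5)"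
      by (rule V) (use P in auto)
    finally show ?thesis .
  next
    case f
    have "linked xs (vcol a e c d b)"
      unfolding f by (rule linked_frozen[OF pal])
    also have "linked \<dots> (vcol 1 2 3 4 5)"
      by (rule V) (use P in auto)
    finally show ?thesis .
  next
    case f'
    have "linked xs (vcol e b c d a)"
      unfolding f' by (rule linked_frozen[OF pal])
    also have "linked \<dots> (vcol 1 2 3 4 5)"
      by (rule V) (use P in auto)
    finally show ?thesis .
  qed
qed

subsection \<open>Chromatic numbers and the counterexample\<close>

definition coloring_of :: "nat list \<Rightarrow> nat \<Rightarrow> nat" where
  "coloring_of xs = (\<lambda>v \<in> {1..9}. xs ! (v - 1))"

lemma grid_edges_subset: "(u, v) \<in> grid_edges \<Longrightarrow> u \<in> {1..9} \<and> v \<in> {1..9}"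
  by (auto simp: grid_edges_def)

lemma H_colorings_grid_K5: "H_colorings grid_graph K5 = coloring_of ` {xs. proper xs}"
proof (intro set_eqI iffI)
  fix \<phi> assume \<phi>: "\<phi> \<in> H_colorings grid_graph K5"
  define xs where "xs = map \<phi> [1..<10]"
  have nth: "xs ! (v - 1) = \<phi> v" if "v \<in> {1..9}" for v
    using that by (auto simp: xs_def)
  have "\<phi> = coloring_of xs"
    using \<phi> nth
    by (auto simp: coloring_of_def fun_eq_iff H_colorings_def grid_graph_def PiE_def extensional_def)
  moreover have "proper xs"
    unfolding proper_def
  proof (intro conjI ballI)
    show "length xs = 9" by (simp add: xs_def)
    have "\<phi> v \<in> {1..5}" if "v \<in> {1..9}" for v
      using \<phi> that by (auto simp: H_colorings_def grid_graph_def K5_def complete_graph_def)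
    then show "set xs \<subseteq> {1..5}"
      by (auto simp: xs_def)
    show "case e of (u, v) \<Rightarrow> xs ! (u - 1) \<noteq> xs ! (v - 1)" if "e \<in> grid_edges" for e
    proof (cases e)
      case (Pair u v)
      with that have uv: "(u, v) \<in> grid_edges" by simp
      with \<phi> have "\<phi> u \<noteq> \<phi> v"
        by (auto simp: H_colorings_def grid_graph_def K5_def complete_graph_def)
      with grid_edges_subset[OF uv] nth show ?thesis by (simp add: Pair)
    qed
  qed
  ultimately show "\<phi> \<in> coloring_of ` {xs. proper xs}" by blast
next
  fix \<phi> assume "\<phi> \<in> coloring_of ` {xs. proper xs}"
  then obtain xs where xs: "proper xs" and \<phi>: "\<phi> = coloring_of xs" by blast
  have range: "\<phi> v \<in> {1..5}" if "v \<in> {1..9}" for v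
  proof -
    have "xs ! (v - 1) \<in> set xs"
      using that xs by (intro nth_mem) (auto simp: proper_def)
    with xs that show ?thesis
      unfolding proper_def \<phi> coloring_of_def by auto
  qed
  have edge: "\<phi> u \<noteq> \<phi> v" if "(u, v) \<in> grid_edges" for u v
    using that xs grid_edges_subset[OF that] unfolding proper_def \<phi> coloring_of_def by auto
  have "(\<phi> u, \<phi> v) \<in> parcs K5" if "(u, v) \<in> grid_edges \<or> (v, u) \<in> grid_edges" for u v
    using that grid_edges_subset edge[of u v] edge[of v u] range[of u] range[of v]
    unfolding K5_def complete_graph_def by auto
  moreover have "\<phi> \<in> {1..9} \<rightarrow>\<^sub>E {1..5}"
    using range by (auto simp: \<phi> coloring_of_def)
  ultimately show "\<phi> \<in> H_colorings grid_graph K5"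
    unfolding H_colorings_def grid_graph_def by (auto simp: K5_def complete_graph_def)
qed

text \<open>\<open>recolor\<close> allows equal lists whereas arcs require exactly one difference,
  hence the reflexive closure.\<close>

lemma recolor_coloring_graph:
  assumes "recolor xs ys"
  shows "(coloring_of xs, coloring_of ys) \<in> (parcs (coloring_graph grid_graph K5))\<^sup>*"
proof (cases "coloring_of xs = coloring_of ys")
  case False
  have pr: "proper xs" "proper ys" and diff: "at_most_one_diff xs ys"
    using assms by (auto simp: recolor_def)
  have len: "length xs = 9" using pr by (simp add: proper_def)
  from False obtain v where v: "v \<in> {1..9}" "xs ! (v - 1) \<noteq> ys ! (v - 1)"
    by (auto simp: coloring_of_def fun_eq_iff split: if_splits)
  have uniq: "w = v" if "w \<in> {1..9}" "xs ! (w - 1) \<noteq> ys ! (w - 1)" for w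
  proof -
    have "w - 1 = v - 1"
      using at_most_one_diff_nth[OF diff] v that len by auto
    \<comment> \<open>Truncated subtraction can be cancelled because both vertices are at least
      1.\<close>
    with v(1) that(1) show ?thesis by auto
  qed
  have "\<exists>!v. v \<in> pverts grid_graph \<and> coloring_of xs v \<noteq> coloring_of ys v"
  proof (rule ex1I[of _ v])
    show "v \<in> pverts grid_graph \<and> coloring_of xs v \<noteq> coloring_of ys v"
      using v by (simp add: grid_graph_def coloring_of_def)
    show "w = v" if "w \<in> pverts grid_graph \<and> coloring_of xs w \<noteq> coloring_of ys w" for w
      by (rule uniq) (use that in \<open>simp_all add: grid_graph_def coloring_of_def split: if_splits\<close>)
  qed
  moreover have "coloring_of xs \<in> H_colorings grid_graph K5" "coloring_of ys \<in> H_colorings grid_graph K5"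
    using pr by (auto simp: H_colorings_grid_K5)
  ultimately show ?thesis
    by (intro r_into_rtrancl) (simp add: coloring_graph_def)
qed simp

lemma linked_coloring_graph:
  "linked xs ys \<Longrightarrow>
    (coloring_of xs, coloring_of ys) \<in> (parcs (coloring_graph grid_graph K5))\<^sup>*"
  by (induction rule: rtranclp_induct) (auto intro: rtrancl_trans recolor_coloring_graph)

lemma coloring_graph_grid_K5_rtrancl:
  assumes "\<phi> \<in> H_colorings grid_graph K5" "\<psi> \<in> H_colorings grid_graph K5"
  shows "(\<phi>, \<psi>) \<in> (parcs (coloring_graph grid_graph K5))\<^sup>*"
proof -
  obtain xs ys where xs: "proper xs" "\<phi> = coloring_of xs" and ys: "proper ys" "\<psi> = coloring_of ys"
    using assms by (auto simp: H_colorings_grid_K5)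
  have "linked xs ys"
    using proper_linked_12345 xs(1) ys(1) by (meson linked_sym rtranclp_trans)
  then show ?thesis
    unfolding xs(2) ys(2) by (rule linked_coloring_graph)
qed

lemma H_colorings_grid_K5_nonempty: "H_colorings grid_graph K5 \<noteq> {}"
proof -
  have "proper (vcol 1 2 3 4 5)"
    by (auto simp: vcol_def proper_grid)
  then show ?thesis
    by (auto simp: H_colorings_grid_K5)
qed

lemma connected_coloring_graph_grid_K5:
  "Digraph_Component.connected (with_proj (coloring_graph grid_graph K5))"
proof -
  interpret C: pair_wf_digraph "coloring_graph grid_graph K5"
    by (rule wf_coloring_graph)
  have pv: "pverts (coloring_graph grid_graph K5) = H_colorings grid_graph K5"
    by (simp add: coloring_graph_def)
  have "\<phi> \<rightarrow>\<^sup>*\<^bsub>with_proj (coloring_graph grid_graph K5)\<^esub> \<psi>"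
    if "\<phi> \<in> H_colorings grid_graph K5" "\<psi> \<in> H_colorings grid_graph K5" for \<phi> \<psi>
    using that coloring_graph_grid_K5_rtrancl[OF that] by (simp add: C.reachable_conv pv)
  \<comment> \<open>Connectedness is defined through the symmetrised digraph, to which reachability
    is transferred.\<close>
  then show ?thesis
    unfolding Digraph_Component.connected_def strongly_connected_def
    using H_colorings_grid_K5_nonempty C.reachable_mk_symmetricI by (simp add: pv)
qed

lemma k_connected_0_Hom_grid_K5: "k_connected 0 (Hom_complex grid_graph K5)"
proof (rule k_connected_0_if_path_connected)
  obtain \<phi> where "\<phi> \<in> H_colorings grid_graph K5"
    using H_colorings_grid_K5_nonempty by blast
  then show "topspace (Hom_complex grid_graph K5) \<noteq> {}"
    using coloring_point_in_topspace[OF pair_graph_grid_graph] by blast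
  show "path_connected_space (Hom_complex grid_graph K5)"
    by (rule path_connected_Hom_complex[OF pair_graph_grid_graph coloring_graph_grid_K5_rtrancl])
qed

section \<open>Bounds on chromatic numbers\<close>

lemma H_colorings_complete_relabel:
  assumes "\<phi> \<in> H_colorings G (complete_graph V)" "inj_on f V" "f ` V \<subseteq> W"
    and "parcs G \<subseteq> pverts G \<times> pverts G"
  shows "restrict (f \<circ> \<phi>) (pverts G) \<in> H_colorings G (complete_graph W)"
  using assms unfolding H_colorings_def complete_graph_def
  by (fastforce simp: inj_on_eq_iff)

text \<open>The corners use up all four colours, so the mid-side vertices must follow one of the two
  frozen patterns, whose centre needs a fifth colour. Allowing all \<open>n\<close> up to 4 serves
  the minimality in \<open>chromatic_number\<close>.\<close>

lemma grid_not_4_colorable: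
  assumes "\<phi> \<in> H_colorings grid_graph (complete_graph {..<n::nat})" "n \<le> 4"
  shows False
proof -
  have range: "\<phi> v \<in> {..<4}" if "v \<in> {1..9}" for v
  proof -
    have "\<phi> v \<in> {..<n}"
      using assms(1) that by (auto simp: H_colorings_def grid_graph_def complete_graph_def)
    with assms(2) show ?thesis by simp
  qed
  have edge: "\<phi> u \<noteq> \<phi> v" if "(u, v) \<in> grid_edges" for u v
    using assms(1) that by (auto simp: H_colorings_def grid_graph_def complete_graph_def)
  have E: "\<forall>(u, v) \<in> grid_edges. \<phi> u \<noteq> \<phi> v"
    using edge by blast
  have "card {\<phi> 1, \<phi> 3, \<phi> 7, \<phi> 9} = 4"
    using E by (simp add: grid_edges_def)
  then have "{\<phi> 1, \<phi> 3, \<phi> 7, \<phi> 9} = {..<4}"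
    using range by (intro card_subset_eq) auto
  then have "{\<phi> 2, \<phi> 4, \<phi> 6, \<phi> 8, \<phi> 5} \<subseteq> {\<phi> 1, \<phi> 3, \<phi> 7, \<phi> 9}"
    using range by simp
  then have "\<phi> 2 \<in> {\<phi> 7, \<phi> 9}" "\<phi> 4 \<in> {\<phi> 3, \<phi> 9}" "\<phi> 6 \<in> {\<phi> 1, \<phi> 7}" "\<phi> 8 \<in> {\<phi> 1, \<phi> 3}"
    "\<phi> 5 \<in> {\<phi> 1, \<phi> 3, \<phi> 7, \<phi> 9}"
    using E by (auto simp: grid_edges_def)
  \<comment> \<open>only two colorings of the 4-cycle 2, 4, 8, 6 remain, and each uses all four colours\<close>
  with E show False
    by (auto simp: grid_edges_def)
qed

text \<open>Shifts the colours 1 to 5 of \<open>K5\<close> down to the initial segment used by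
  \<open>chromatic_number\<close>.\<close>

lemma H_colorings_5_nonempty:
  assumes "H_colorings G K5 \<noteq> {}" "parcs G \<subseteq> pverts G \<times> pverts G"
  shows "H_colorings G (complete_graph {..<5::nat}) \<noteq> {}"
proof -
  obtain \<phi> where \<phi>: "\<phi> \<in> H_colorings G (complete_graph {1..5::nat})"
    using assms(1) by (auto simp: K5_def)
  have "inj_on (\<lambda>i::nat. i - 1) {1..5}" "(\<lambda>i. i - 1) ` {1..5} \<subseteq> {..<5::nat}"
    by (auto simp: inj_on_def)
  from H_colorings_complete_relabel[OF \<phi> this assms(2)] show ?thesis by blast
qed

lemma chromatic_number_grid: "chromatic_number grid_graph = 5"
  unfolding chromatic_number_def
proof (rule Least_equality)
  show "H_colorings grid_graph (complete_graph {..<5::nat}) \<noteq> {}"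
    by (rule H_colorings_5_nonempty[OF H_colorings_grid_K5_nonempty])
      (use grid_edges_subset in \<open>auto simp: grid_graph_def\<close>)
  show "5 \<le> n" if "H_colorings grid_graph (complete_graph {..<n}) \<noteq> {}" for n :: nat
  proof (rule ccontr)
    assume "\<not> 5 \<le> n"
    then have "n \<le> 4" by simp
    with that show False
      using grid_not_4_colorable by blast
  qed
qed

lemma H_colorings_complete_self: "restrict id V \<in> H_colorings (complete_graph V) (complete_graph V)"
  unfolding H_colorings_def complete_graph_def by simp

lemma chromatic_number_K5_le: "chromatic_number K5 \<le> 5"
  unfolding chromatic_number_def
proof (rule Least_le, rule H_colorings_5_nonempty)
  show "H_colorings K5 K5 \<noteq> {}"
    unfolding K5_def using H_colorings_complete_self by blast
  show "parcs K5 \<subseteq> pverts K5 \<times> pverts K5"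
    by (rule subsetI) (auto simp only: K5_def complete_graph_def pair_pre_digraph.simps)
qed

theorem mainTheorem1:
  shows "chromatic_number grid_graph = 5 \<and>
    k_connected 0 (Hom_complex grid_graph K5) \<and>
    Digraph_Component.connected (with_proj (coloring_graph grid_graph K5)) \<and>
    \<not> (k_connected 0 (Hom_complex grid_graph K5) \<longrightarrow>
         int (chromatic_number K5) \<ge> int (chromatic_number grid_graph) + 0 + 1) \<and>
    \<not> (\<forall>(G :: nat pair_pre_digraph) (H :: nat pair_pre_digraph) (k :: int).
         pair_graph G \<longrightarrow> pair_graph H \<longrightarrow> -1 \<le> k \<longrightarrow>
         k_connected k (Hom_complex G H) \<longrightarrow>
         int (chromatic_number H) \<ge> int (chromatic_number G) + k + 1)"
proof -
  \<comment> \<open>The inequality would require at least six colours for \<open>K5\<close>.\<close>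
  have bound: "\<not> int (chromatic_number K5) \<ge> int (chromatic_number grid_graph) + 0 + 1"
    using chromatic_number_K5_le by (simp add: chromatic_number_grid)
  have "pair_graph K5"
    by (simp add: K5_def pair_graph_complete_graph)
  with bound show ?thesis
    using pair_graph_grid_graph chromatic_number_grid k_connected_0_Hom_grid_K5
      connected_coloring_graph_grid_K5
    \<comment> \<open>The arithmetic facts give -1 \<le> 0 for the instance \<open>k\<close> =
      0.\<close>
    by (metis neg_equal_0_iff_equal neg_le_0_iff_le zero_le_one)
qed

end
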